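(* Let $M\mapsto M^*$ be the translation from the untyped delimited control calculus to the untyped effect handler calculus that is homomorphic on all core constructs and satisfies $(\mathcal{S}_0k.N)^*=\mathit{shift0}\,\{\lambda k.N^*\}$ and $\langle M\mid x.N\rangle^*=\mathtt{handle}\,M^*\,\mathtt{with}\,\{\mathtt{return}\,x\mapsto N^*\}\uplus\{\mathit{shift0}\,y\,f\mapsto y!\,f\}$, where $\mathit{shift0}$ is a fixed operation name. Then for all computations $M,N$ of the delimited control calculus, $M\to N$ implies $M^*\to^{+}N^*$.
   Context: Core syntax (shared). Values $V ::= x \mid () \mid (V_1,V_2) \mid \ell\,V \mid \{M\}$; computations $M,N ::= \mathtt{let}\,(x,y)=V\,\mathtt{in}\,M \mid \mathtt{case}\,V\,\mathtt{of}\,\{\ell_i x_i\mapsto M_i\}_i \mid V! \mid \mathtt{return}\,V \mid \mathtt{let}\,x\Leftarrow M\,\mathtt{in}\,N \mid \lambda x.M \mid M\,V \mid \langle M_1,M_2\rangle \mid \mathrm{prj}_i M$. Core $\beta$-rules: $\mathtt{let}\,(x,y)=(V_1,V_2)\,\mathtt{in}\,M \to_\beta M[V_1/x,V_2/y]$; $\mathtt{case}\,\ell_j V\,\mathtt{of}\,\{\dots\ell_j x_j\mapsto M_j\dots\}\to_\beta M_j[V/x_j]$; $\{M\}!\to_\beta M$; $\mathtt{let}\,x\Leftarrow\mathtt{return}\,V\,\mathtt{in}\,N\to_\beta N[V/x]$; $(\lambda x.M)V\to_\beta M[V/x]$; $\mathrm{prj}_i\langle M_1,M_2\rangle\to_\beta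 M_i$. Basic frames $B ::= \mathtt{let}\,x\Leftarrow[\,]\,\mathtt{in}\,N\mid[\,]\,V\mid\mathrm{prj}_i[\,]$; hoisting contexts $\mathcal{H}::=[\,]\mid\mathcal{H}[B]$. In each calculus $M\to N$ iff $M=K[M']$, $N=K[N']$ with $M'\to_\beta N'$ and $K$ an evaluation context of that calculus; $\to^+$ is the transitive closure. Delimited control calculus: adds computations $\mathcal{S}_0k.M$ and $\langle M\mid x.N\rangle$; evaluation contexts $K::=[\,]\mid K[B]\mid K[\langle[\,]\mid x.N\rangle]$; extra rules $\langle\mathtt{return}\,V\mid x.N\rangle\to_\beta N[V/x]$ and $\langle\mathcal{H}[\mathcal{S}_0k.M]\mid x.N\rangle\to_\beta M[\{\lambda y.\langle\mathcal{H}[\mathtt{return}\,y]\mid x.N\rangle\}/k]$. Effect handler calculus: operation names $\mathit{op}$; adds computations $\mathit{op}\,V$ and $\mathtt{handle}\,M\,\mathtt{with}\,H$, where $H$ has a return clause $\mathtt{return}\,x\mapsto N_{\mathrm{ret}}$ and operation clauses $\mathit{op}\,p\,k\mapsto N_{\mathit{op}}$ for $\mathit{op}$ in a finite set $\mathrm{ops}(H)$; evaluation contexts $K::=[\,]\mid K[B]\mid K[\mathtt{handle}\,[\,]\,\mathtt{with}\,H]$; extra rules $\mathtt{handle}\,(\mathtt{return}\,V)\,\mathtt{with}\,H\to_\beta N_{\mathrm{ret}}[V/x]$ and $\mathtt{handle}\,\mathcal{H}[\mathit{op}\,V]\,\mathtt{with}\,H\to_\beta N_{\mathit{op}}[V/p,\{\lambda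 y.\mathtt{handle}\,\mathcal{H}[\mathtt{return}\,y]\,\mathtt{with}\,H\}/k]$ for $\mathit{op}\in\mathrm{ops}(H)$. *)

theory Defs
  imports "HOL-Library.Finite_Map"
begin

text \<open>
  Terms are represented up to renaming of bound variables by de Bruijn indices; free variables
  are the indices not bound by an enclosing binder, so terms may be open. Where two
  variables are bound at once, the one written last has index 0: in \<open>let (x,y) = V in M\<close> the
  variable \<open>y\<close> has index 0 and \<open>x\<close> has index 1 in \<open>M\<close>. The branches of a case expression form a
  finite map from labels to computations with one bound variable each. Evaluation contexts have
  no binder around their hole, so filling never captures. Putting a term or context under a new
  binder renames its free variables by \<^const>\<open>Suc\<close>.

  \<open>inst M V\<close> is \<open>M[V/x]\<close> for the variable \<open>x\<close> of index 0; \<open>inst2 M V1 V0\<close> is the simultaneous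
  substitution of \<open>V1\<close> for index 1 and \<open>V0\<close> for index 0. Contexts grow at their hole: the
  constructors applied to \<open>K\<close> and \<open>B\<close> build \<open>K[B]\<close>.
\<close>

definition ren_up :: "(nat \<Rightarrow> nat) \<Rightarrow> nat \<Rightarrow> nat" where
  "ren_up r = case_nat 0 (\<lambda>n. Suc (r n))"

subsection \<open>Delimited control calculus\<close>

datatype
  'l del_val =
    DVar nat
  | DUnit
  | DPair "'l del_val" "'l del_val"
  | DInj 'l "'l del_val"
  | DThunk "'l del_comp"
and 'l del_comp =
    DLetPair "'l del_val" "'l del_comp"
  | DCase "'l del_val" "('l, 'l del_comp) fmap"
  | DForce "'l del_val"
  | DReturn "'l del_val"
  | DLet "'l del_comp" "'l del_comp"
  | DLam "'l del_comp"
  | DApp "'l del_comp" "'l del_val"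
  | DCPair "'l del_comp" "'l del_comp"
  | DPrj1 "'l del_comp"
  | DPrj2 "'l del_comp"
  | DShift0 "'l del_comp"
  | DReset "'l del_comp" "'l del_comp"

text \<open>\<open>DShift0 M\<close> is \<open>S\<^sub>0k. M\<close> and \<open>DReset M N\<close> is \<open>\<langle>M | x. N\<rangle>\<close>, with \<open>k\<close> bound in \<open>M\<close> and \<open>x\<close> in \<open>N\<close> (not in \<open>M\<close>).\<close>

primrec del_ren_val :: "(nat \<Rightarrow> nat) \<Rightarrow> 'l del_val \<Rightarrow> 'l del_val"
  and del_ren :: "(nat \<Rightarrow> nat) \<Rightarrow> 'l del_comp \<Rightarrow> 'l del_comp" where
  "del_ren_val r (DVar n) = DVar (r n)"
| "del_ren_val r DUnit = DUnit"
| "del_ren_val r (DPair V W) = DPair (del_ren_val r V) (del_ren_val r W)"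
| "del_ren_val r (DInj l V) = DInj l (del_ren_val r V)"
| "del_ren_val r (DThunk M) = DThunk (del_ren r M)"
| "del_ren r (DLetPair V M) = DLetPair (del_ren_val r V) (del_ren (ren_up (ren_up r)) M)"
| "del_ren r (DCase V bs) = DCase (del_ren_val r V) (fmmap (\<lambda>M. del_ren (ren_up r) M) bs)"
| "del_ren r (DForce V) = DForce (del_ren_val r V)"
| "del_ren r (DReturn V) = DReturn (del_ren_val r V)"
| "del_ren r (DLet M N) = DLet (del_ren r M) (del_ren (ren_up r) N)"
| "del_ren r (DLam M) = DLam (del_ren (ren_up r) M)"
| "del_ren r (DApp M V) = DApp (del_ren r M) (del_ren_val r V)"
| "del_ren r (DCPair M N) = DCPair (del_ren r M) (del_ren r N)"
| "del_ren r (DPrj1 M) = DPrj1 (del_ren r M)"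
| "del_ren r (DPrj2 M) = DPrj2 (del_ren r M)"
| "del_ren r (DShift0 M) = DShift0 (del_ren (ren_up r) M)"
| "del_ren r (DReset M N) = DReset (del_ren r M) (del_ren (ren_up r) N)"

definition del_up :: "(nat \<Rightarrow> 'l del_val) \<Rightarrow> nat \<Rightarrow> 'l del_val" where
  "del_up s = case_nat (DVar 0) (\<lambda>n. del_ren_val Suc (s n))"

primrec del_subst_val :: "(nat \<Rightarrow> 'l del_val) \<Rightarrow> 'l del_val \<Rightarrow> 'l del_val"
  and del_subst :: "(nat \<Rightarrow> 'l del_val) \<Rightarrow> 'l del_comp \<Rightarrow> 'l del_comp" where
  "del_subst_val s (DVar n) = s n"
| "del_subst_val s DUnit = DUnit"
| "del_subst_val s (DPair V W) = DPair (del_subst_val s V) (del_subst_val s W)"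
| "del_subst_val s (DInj l V) = DInj l (del_subst_val s V)"
| "del_subst_val s (DThunk M) = DThunk (del_subst s M)"
| "del_subst s (DLetPair V M) = DLetPair (del_subst_val s V) (del_subst (del_up (del_up s)) M)"
| "del_subst s (DCase V bs) = DCase (del_subst_val s V) (fmmap (\<lambda>M. del_subst (del_up s) M) bs)"
| "del_subst s (DForce V) = DForce (del_subst_val s V)"
| "del_subst s (DReturn V) = DReturn (del_subst_val s V)"
| "del_subst s (DLet M N) = DLet (del_subst s M) (del_subst (del_up s) N)"
| "del_subst s (DLam M) = DLam (del_subst (del_up s) M)"
| "del_subst s (DApp M V) = DApp (del_subst s M) (del_subst_val s V)"
| "del_subst s (DCPair M N) = DCPair (del_subst s M) (del_subst s N)"
| "del_subst s (DPrj1 M) = DPrj1 (del_subst s M)"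
| "del_subst s (DPrj2 M) = DPrj2 (del_subst s M)"
| "del_subst s (DShift0 M) = DShift0 (del_subst (del_up s) M)"
| "del_subst s (DReset M N) = DReset (del_subst s M) (del_subst (del_up s) N)"

definition del_inst :: "'l del_comp \<Rightarrow> 'l del_val \<Rightarrow> 'l del_comp" where
  "del_inst M V = del_subst (case_nat V DVar) M"

definition del_inst2 :: "'l del_comp \<Rightarrow> 'l del_val \<Rightarrow> 'l del_val \<Rightarrow> 'l del_comp" where
  "del_inst2 M V1 V0 = del_subst (case_nat V0 (case_nat V1 DVar)) M"

datatype 'l del_frame =
    DFLet "'l del_comp"
  | DFApp "'l del_val"
  | DFPrj1
  | DFPrj2

primrec del_fill_frame :: "'l del_frame \<Rightarrow> 'l del_comp \<Rightarrow> 'l del_comp" where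
  "del_fill_frame (DFLet N) M = DLet M N"
| "del_fill_frame (DFApp V) M = DApp M V"
| "del_fill_frame DFPrj1 M = DPrj1 M"
| "del_fill_frame DFPrj2 M = DPrj2 M"

primrec del_ren_frame :: "(nat \<Rightarrow> nat) \<Rightarrow> 'l del_frame \<Rightarrow> 'l del_frame" where
  "del_ren_frame r (DFLet N) = DFLet (del_ren (ren_up r) N)"
| "del_ren_frame r (DFApp V) = DFApp (del_ren_val r V)"
| "del_ren_frame r DFPrj1 = DFPrj1"
| "del_ren_frame r DFPrj2 = DFPrj2"

datatype 'l del_hoist =
    DHHole
  | DHFrame "'l del_hoist" "'l del_frame"

primrec del_fill_hoist :: "'l del_hoist \<Rightarrow> 'l del_comp \<Rightarrow> 'l del_comp" where
  "del_fill_hoist DHHole M = M"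
| "del_fill_hoist (DHFrame H B) M = del_fill_hoist H (del_fill_frame B M)"

primrec del_ren_hoist :: "(nat \<Rightarrow> nat) \<Rightarrow> 'l del_hoist \<Rightarrow> 'l del_hoist" where
  "del_ren_hoist r DHHole = DHHole"
| "del_ren_hoist r (DHFrame H B) = DHFrame (del_ren_hoist r H) (del_ren_frame r B)"

datatype 'l del_ectx =
    DKHole
  | DKFrame "'l del_ectx" "'l del_frame"
  | DKReset "'l del_ectx" "'l del_comp"

primrec del_fill :: "'l del_ectx \<Rightarrow> 'l del_comp \<Rightarrow> 'l del_comp" where
  "del_fill DKHole M = M"
| "del_fill (DKFrame K B) M = del_fill K (del_fill_frame B M)"
| "del_fill (DKReset K N) M = del_fill K (DReset M N)"

inductive del_beta :: "'l del_comp \<Rightarrow> 'l del_comp \<Rightarrow> bool" where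
  "del_beta (DLetPair (DPair V1 V2) M) (del_inst2 M V1 V2)"
| "fmlookup bs l = Some M \<Longrightarrow> del_beta (DCase (DInj l V) bs) (del_inst M V)"
| "del_beta (DForce (DThunk M)) M"
| "del_beta (DLet (DReturn V) N) (del_inst N V)"
| "del_beta (DApp (DLam M) V) (del_inst M V)"
| "del_beta (DPrj1 (DCPair M1 M2)) M1"
| "del_beta (DPrj2 (DCPair M1 M2)) M2"
| "del_beta (DReset (DReturn V) N) (del_inst N V)"
| "del_beta
     (DReset (del_fill_hoist H (DShift0 M)) N)
     (del_inst M (DThunk (DLam
        (DReset (del_fill_hoist (del_ren_hoist Suc H) (DReturn (DVar 0)))
                (del_ren (ren_up Suc) N)))))"

inductive del_step :: "'l del_comp \<Rightarrow> 'l del_comp \<Rightarrow> bool" where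
  "del_beta M N \<Longrightarrow> del_step (del_fill K M) (del_fill K N)"

subsection \<open>Effect handler calculus\<close>

datatype
  ('l, 'op) eff_val =
    EVar nat
  | EUnit
  | EPair "('l, 'op) eff_val" "('l, 'op) eff_val"
  | EInj 'l "('l, 'op) eff_val"
  | EThunk "('l, 'op) eff_comp"
and ('l, 'op) eff_comp =
    ELetPair "('l, 'op) eff_val" "('l, 'op) eff_comp"
  | ECase "('l, 'op) eff_val" "('l, ('l, 'op) eff_comp) fmap"
  | EForce "('l, 'op) eff_val"
  | EReturn "('l, 'op) eff_val"
  | ELet "('l, 'op) eff_comp" "('l, 'op) eff_comp"
  | ELam "('l, 'op) eff_comp"
  | EApp "('l, 'op) eff_comp" "('l, 'op) eff_val"
  | ECPair "('l, 'op) eff_comp" "('l, 'op) eff_comp"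
  | EPrj1 "('l, 'op) eff_comp"
  | EPrj2 "('l, 'op) eff_comp"
  | EOp 'op "('l, 'op) eff_val"
  | EHandle "('l, 'op) eff_comp" "('l, 'op) eff_comp" "('op, ('l, 'op) eff_comp) fmap"

text \<open>
  \<open>EHandle M N cs\<close> is \<open>handle M with {return x \<mapsto> N} \<uplus> cs\<close>. The domain of the finite map \<open>cs\<close> is
  \<open>ops(H)\<close>; in the clause \<open>op p k \<mapsto> C\<close> the variable \<open>k\<close> has index 0 and \<open>p\<close> has index 1 in \<open>C\<close>.
\<close>

primrec eff_ren_val :: "(nat \<Rightarrow> nat) \<Rightarrow> ('l, 'op) eff_val \<Rightarrow> ('l, 'op) eff_val"
  and eff_ren :: "(nat \<Rightarrow> nat) \<Rightarrow> ('l, 'op) eff_comp \<Rightarrow> ('l, 'op) eff_comp" where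
  "eff_ren_val r (EVar n) = EVar (r n)"
| "eff_ren_val r EUnit = EUnit"
| "eff_ren_val r (EPair V W) = EPair (eff_ren_val r V) (eff_ren_val r W)"
| "eff_ren_val r (EInj l V) = EInj l (eff_ren_val r V)"
| "eff_ren_val r (EThunk M) = EThunk (eff_ren r M)"
| "eff_ren r (ELetPair V M) = ELetPair (eff_ren_val r V) (eff_ren (ren_up (ren_up r)) M)"
| "eff_ren r (ECase V bs) = ECase (eff_ren_val r V) (fmmap (\<lambda>M. eff_ren (ren_up r) M) bs)"
| "eff_ren r (EForce V) = EForce (eff_ren_val r V)"
| "eff_ren r (EReturn V) = EReturn (eff_ren_val r V)"
| "eff_ren r (ELet M N) = ELet (eff_ren r M) (eff_ren (ren_up r) N)"
| "eff_ren r (ELam M) = ELam (eff_ren (ren_up r) M)"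
| "eff_ren r (EApp M V) = EApp (eff_ren r M) (eff_ren_val r V)"
| "eff_ren r (ECPair M N) = ECPair (eff_ren r M) (eff_ren r N)"
| "eff_ren r (EPrj1 M) = EPrj1 (eff_ren r M)"
| "eff_ren r (EPrj2 M) = EPrj2 (eff_ren r M)"
| "eff_ren r (EOp oper V) = EOp oper (eff_ren_val r V)"
| "eff_ren r (EHandle M N cs) =
     EHandle (eff_ren r M) (eff_ren (ren_up r) N) (fmmap (\<lambda>C. eff_ren (ren_up (ren_up r)) C) cs)"

definition eff_up :: "(nat \<Rightarrow> ('l, 'op) eff_val) \<Rightarrow> nat \<Rightarrow> ('l, 'op) eff_val" where
  "eff_up s = case_nat (EVar 0) (\<lambda>n. eff_ren_val Suc (s n))"

primrec eff_subst_val :: "(nat \<Rightarrow> ('l, 'op) eff_val) \<Rightarrow> ('l, 'op) eff_val \<Rightarrow> ('l, 'op) eff_val"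
  and eff_subst :: "(nat \<Rightarrow> ('l, 'op) eff_val) \<Rightarrow> ('l, 'op) eff_comp \<Rightarrow> ('l, 'op) eff_comp" where
  "eff_subst_val s (EVar n) = s n"
| "eff_subst_val s EUnit = EUnit"
| "eff_subst_val s (EPair V W) = EPair (eff_subst_val s V) (eff_subst_val s W)"
| "eff_subst_val s (EInj l V) = EInj l (eff_subst_val s V)"
| "eff_subst_val s (EThunk M) = EThunk (eff_subst s M)"
| "eff_subst s (ELetPair V M) = ELetPair (eff_subst_val s V) (eff_subst (eff_up (eff_up s)) M)"
| "eff_subst s (ECase V bs) = ECase (eff_subst_val s V) (fmmap (\<lambda>M. eff_subst (eff_up s) M) bs)"
| "eff_subst s (EForce V) = EForce (eff_subst_val s V)"
| "eff_subst s (EReturn V) = EReturn (eff_subst_val s V)"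
| "eff_subst s (ELet M N) = ELet (eff_subst s M) (eff_subst (eff_up s) N)"
| "eff_subst s (ELam M) = ELam (eff_subst (eff_up s) M)"
| "eff_subst s (EApp M V) = EApp (eff_subst s M) (eff_subst_val s V)"
| "eff_subst s (ECPair M N) = ECPair (eff_subst s M) (eff_subst s N)"
| "eff_subst s (EPrj1 M) = EPrj1 (eff_subst s M)"
| "eff_subst s (EPrj2 M) = EPrj2 (eff_subst s M)"
| "eff_subst s (EOp oper V) = EOp oper (eff_subst_val s V)"
| "eff_subst s (EHandle M N cs) =
     EHandle (eff_subst s M) (eff_subst (eff_up s) N)
       (fmmap (\<lambda>C. eff_subst (eff_up (eff_up s)) C) cs)"

definition eff_inst :: "('l, 'op) eff_comp \<Rightarrow> ('l, 'op) eff_val \<Rightarrow> ('l, 'op) eff_comp" where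
  "eff_inst M V = eff_subst (case_nat V EVar) M"

definition eff_inst2 :: "('l, 'op) eff_comp \<Rightarrow> ('l, 'op) eff_val \<Rightarrow> ('l, 'op) eff_val \<Rightarrow> ('l, 'op) eff_comp" where
  "eff_inst2 M V1 V0 = eff_subst (case_nat V0 (case_nat V1 EVar)) M"

datatype ('l, 'op) eff_frame =
    EFLet "('l, 'op) eff_comp"
  | EFApp "('l, 'op) eff_val"
  | EFPrj1
  | EFPrj2

primrec eff_fill_frame :: "('l, 'op) eff_frame \<Rightarrow> ('l, 'op) eff_comp \<Rightarrow> ('l, 'op) eff_comp" where
  "eff_fill_frame (EFLet N) M = ELet M N"
| "eff_fill_frame (EFApp V) M = EApp M V"
| "eff_fill_frame EFPrj1 M = EPrj1 M"
| "eff_fill_frame EFPrj2 M = EPrj2 M"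

primrec eff_ren_frame :: "(nat \<Rightarrow> nat) \<Rightarrow> ('l, 'op) eff_frame \<Rightarrow> ('l, 'op) eff_frame" where
  "eff_ren_frame r (EFLet N) = EFLet (eff_ren (ren_up r) N)"
| "eff_ren_frame r (EFApp V) = EFApp (eff_ren_val r V)"
| "eff_ren_frame r EFPrj1 = EFPrj1"
| "eff_ren_frame r EFPrj2 = EFPrj2"

datatype ('l, 'op) eff_hoist =
    EHHole
  | EHFrame "('l, 'op) eff_hoist" "('l, 'op) eff_frame"

primrec eff_fill_hoist :: "('l, 'op) eff_hoist \<Rightarrow> ('l, 'op) eff_comp \<Rightarrow> ('l, 'op) eff_comp" where
  "eff_fill_hoist EHHole M = M"
| "eff_fill_hoist (EHFrame H B) M = eff_fill_hoist H (eff_fill_frame B M)"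

primrec eff_ren_hoist :: "(nat \<Rightarrow> nat) \<Rightarrow> ('l, 'op) eff_hoist \<Rightarrow> ('l, 'op) eff_hoist" where
  "eff_ren_hoist r EHHole = EHHole"
| "eff_ren_hoist r (EHFrame H B) = EHFrame (eff_ren_hoist r H) (eff_ren_frame r B)"

datatype ('l, 'op) eff_ectx =
    EKHole
  | EKFrame "('l, 'op) eff_ectx" "('l, 'op) eff_frame"
  | EKHandle "('l, 'op) eff_ectx" "('l, 'op) eff_comp" "('op, ('l, 'op) eff_comp) fmap"

primrec eff_fill :: "('l, 'op) eff_ectx \<Rightarrow> ('l, 'op) eff_comp \<Rightarrow> ('l, 'op) eff_comp" where
  "eff_fill EKHole M = M"
| "eff_fill (EKFrame K B) M = eff_fill K (eff_fill_frame B M)"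
| "eff_fill (EKHandle K N cs) M = eff_fill K (EHandle M N cs)"

inductive eff_beta :: "('l, 'op) eff_comp \<Rightarrow> ('l, 'op) eff_comp \<Rightarrow> bool" where
  "eff_beta (ELetPair (EPair V1 V2) M) (eff_inst2 M V1 V2)"
| "fmlookup bs l = Some M \<Longrightarrow> eff_beta (ECase (EInj l V) bs) (eff_inst M V)"
| "eff_beta (EForce (EThunk M)) M"
| "eff_beta (ELet (EReturn V) N) (eff_inst N V)"
| "eff_beta (EApp (ELam M) V) (eff_inst M V)"
| "eff_beta (EPrj1 (ECPair M1 M2)) M1"
| "eff_beta (EPrj2 (ECPair M1 M2)) M2"
| "eff_beta (EHandle (EReturn V) N cs) (eff_inst N V)"
| "fmlookup cs oper = Some C \<Longrightarrow>
   eff_beta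
     (EHandle (eff_fill_hoist H (EOp oper V)) N cs)
     (eff_inst2 C V (EThunk (ELam
        (EHandle (eff_fill_hoist (eff_ren_hoist Suc H) (EReturn (EVar 0)))
                 (eff_ren (ren_up Suc) N)
                 (fmmap (eff_ren (ren_up (ren_up Suc))) cs)))))"

inductive eff_step :: "('l, 'op) eff_comp \<Rightarrow> ('l, 'op) eff_comp \<Rightarrow> bool" where
  "eff_beta M N \<Longrightarrow> eff_step (eff_fill K M) (eff_fill K N)"

subsection \<open>Translation\<close>

text \<open>In the clause for \<open>shift0\<close> the index 1 is the operation's argument \<open>y\<close> and 0 the resumption \<open>f\<close>.\<close>

primrec tr_val :: "'op \<Rightarrow> 'l del_val \<Rightarrow> ('l, 'op) eff_val"
  and tr :: "'op \<Rightarrow> 'l del_comp \<Rightarrow> ('l, 'op) eff_comp" where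
  "tr_val shift0 (DVar n) = EVar n"
| "tr_val shift0 DUnit = EUnit"
| "tr_val shift0 (DPair V W) = EPair (tr_val shift0 V) (tr_val shift0 W)"
| "tr_val shift0 (DInj l V) = EInj l (tr_val shift0 V)"
| "tr_val shift0 (DThunk M) = EThunk (tr shift0 M)"
| "tr shift0 (DLetPair V M) = ELetPair (tr_val shift0 V) (tr shift0 M)"
| "tr shift0 (DCase V bs) = ECase (tr_val shift0 V) (fmmap (\<lambda>M. tr shift0 M) bs)"
| "tr shift0 (DForce V) = EForce (tr_val shift0 V)"
| "tr shift0 (DReturn V) = EReturn (tr_val shift0 V)"
| "tr shift0 (DLet M N) = ELet (tr shift0 M) (tr shift0 N)"
| "tr shift0 (DLam M) = ELam (tr shift0 M)"
| "tr shift0 (DApp M V) = EApp (tr shift0 M) (tr_val shift0 V)"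
| "tr shift0 (DCPair M N) = ECPair (tr shift0 M) (tr shift0 N)"
| "tr shift0 (DPrj1 M) = EPrj1 (tr shift0 M)"
| "tr shift0 (DPrj2 M) = EPrj2 (tr shift0 M)"
| "tr shift0 (DShift0 N) = EOp shift0 (EThunk (ELam (tr shift0 N)))"
| "tr shift0 (DReset M N) =
     EHandle (tr shift0 M) (tr shift0 N)
       (fmupd shift0 (EApp (EForce (EVar 1)) (EVar 0)) fmempty)"

end

theory Submission
  imports Defs
begin

text \<open>
  The translation commutes with renaming, substitution and context filling, so every core rule and
  the return rule of a reset translate to a single step. A control step translates to three steps:
  the handler passes the suspended body \<open>{\<lambda>k. M\<^sup>*}\<close> and the resumption to the clause \<open>y! f\<close>, which
  then forces the body and applies it to the resumption; since the clause has no free variables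
  besides its parameters, the resumption is the translation of the captured continuation.
\<close>

lemma tr_del_ren:
  fixes V :: "'l del_val" and M :: "'l del_comp"
  shows "tr_val s (del_ren_val r V) = eff_ren_val r (tr_val s V)"
  "tr s (del_ren r M) = eff_ren r (tr s M)"
proof (induction V and M arbitrary: r and r)
  case (DCase V bs)
  then show ?case
    by (auto simp: fmap.map_comp intro!: fmap.map_cong0)
\<comment> \<open>Unfolding \<open>ren_up\<close> serves the reset case: a renaming lifted under two
  binders fixes indices 0 and 1, the only ones in the clause \<open>y! f\<close>.\<close>
qed (auto simp: ren_up_def fmmap_fmupd)

text \<open>Lifting shifts the substituted values by \<open>Suc\<close>, so commutation with
  renaming has to come before commutation with substitution.\<close>

lemma tr_del_up: "(\<lambda>n. tr_val s (del_up \<sigma> n)) = eff_up (\<lambda>n. tr_val s (\<sigma> n))"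
  by (rule ext) (simp add: del_up_def eff_up_def tr_del_ren split: nat.split)

lemma tr_del_subst:
  "tr_val s (del_subst_val \<sigma> V) = eff_subst_val (\<lambda>n. tr_val s (\<sigma> n)) (tr_val s V)"
  "tr s (del_subst \<sigma> M) = eff_subst (\<lambda>n. tr_val s (\<sigma> n)) (tr s M)"
proof (induction V and M arbitrary: \<sigma> and \<sigma>)
  case (DCase V bs)
  then show ?case
    by (auto simp: fmap.map_comp tr_del_up intro!: fmap.map_cong0)
\<comment> \<open>A doubly lifted substitution sends indices 0 and 1 to themselves, so the handler
  clause stays fixed here as well.\<close>
qed (auto simp: tr_del_up eff_up_def fmmap_fmupd)

lemma tr_del_inst: "tr s (del_inst M V) = eff_inst (tr s M) (tr_val s V)"
proof -
  have "(\<lambda>n. tr_val s (case_nat V DVar n)) = case_nat (tr_val s V) EVar"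
    by (rule ext) (simp split: nat.split)
  then show ?thesis
    by (simp add: del_inst_def eff_inst_def tr_del_subst)
qed

lemma tr_del_inst2:
  "tr s (del_inst2 M V1 V0) = eff_inst2 (tr s M) (tr_val s V1) (tr_val s V0)"
proof -
  have "(\<lambda>n. tr_val s (case_nat V0 (case_nat V1 DVar) n)) =
      case_nat (tr_val s V0) (case_nat (tr_val s V1) EVar)"
    by (rule ext) (simp split: nat.split)
  then show ?thesis
    by (simp add: del_inst2_def eff_inst2_def tr_del_subst)
qed

primrec tr_frame :: "'op \<Rightarrow> 'l del_frame \<Rightarrow> ('l, 'op) eff_frame" where
  "tr_frame s (DFLet N) = EFLet (tr s N)"
| "tr_frame s (DFApp V) = EFApp (tr_val s V)"
| "tr_frame s DFPrj1 = EFPrj1"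
| "tr_frame s DFPrj2 = EFPrj2"

primrec tr_hoist :: "'op \<Rightarrow> 'l del_hoist \<Rightarrow> ('l, 'op) eff_hoist" where
  "tr_hoist s DHHole = EHHole"
| "tr_hoist s (DHFrame H B) = EHFrame (tr_hoist s H) (tr_frame s B)"

primrec tr_ectx :: "'op \<Rightarrow> 'l del_ectx \<Rightarrow> ('l, 'op) eff_ectx" where
  "tr_ectx s DKHole = EKHole"
| "tr_ectx s (DKFrame K B) = EKFrame (tr_ectx s K) (tr_frame s B)"
| "tr_ectx s (DKReset K N) =
     EKHandle (tr_ectx s K) (tr s N) (fmupd s (EApp (EForce (EVar 1)) (EVar 0)) fmempty)"

lemma tr_del_fill_frame: "tr s (del_fill_frame B M) = eff_fill_frame (tr_frame s B) (tr s M)"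
  by (cases B) auto

lemma tr_frame_del_ren_frame: "tr_frame s (del_ren_frame r B) = eff_ren_frame r (tr_frame s B)"
  by (cases B) (auto simp: tr_del_ren)

lemma tr_del_fill_hoist: "tr s (del_fill_hoist H M) = eff_fill_hoist (tr_hoist s H) (tr s M)"
  by (induction H arbitrary: M) (auto simp: tr_del_fill_frame)

lemma tr_hoist_del_ren_hoist: "tr_hoist s (del_ren_hoist r H) = eff_ren_hoist r (tr_hoist s H)"
  by (induction H) (auto simp: tr_frame_del_ren_frame)

lemma tr_del_fill: "tr s (del_fill K M) = eff_fill (tr_ectx s K) (tr s M)"
  by (induction K arbitrary: M) (auto simp: tr_del_fill_frame)

text \<open>Contexts grow at their hole, so plugging \<open>L\<close> into \<open>K\<close> recurses
  on the inner context \<open>L\<close>.\<close>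

primrec eff_ectx_comp :: "('l, 'op) eff_ectx \<Rightarrow> ('l, 'op) eff_ectx \<Rightarrow> ('l, 'op) eff_ectx" where
  "eff_ectx_comp K EKHole = K"
| "eff_ectx_comp K (EKFrame L B) = EKFrame (eff_ectx_comp K L) B"
| "eff_ectx_comp K (EKHandle L N cs) = EKHandle (eff_ectx_comp K L) N cs"

lemma eff_fill_ectx_comp: "eff_fill (eff_ectx_comp K L) M = eff_fill K (eff_fill L M)"
  by (induction L arbitrary: M) auto

text \<open>The given step takes place in some context \<open>L\<close>, hence the filled one takes
  place in the composite of \<open>K\<close> and \<open>L\<close>.\<close>

lemma eff_step_fill: "eff_step M N \<Longrightarrow> eff_step (eff_fill K M) (eff_fill K N)"
  by (metis eff_fill_ectx_comp eff_step.cases eff_step.intros)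

lemma eff_steps_fill: "eff_step\<^sup>+\<^sup>+ M N \<Longrightarrow> eff_step\<^sup>+\<^sup>+ (eff_fill K M) (eff_fill K N)"
  by (induction rule: tranclp_induct) (auto intro: eff_step_fill tranclp.intros)

lemma eff_step_beta: "eff_beta M N \<Longrightarrow> eff_step M N"
  using eff_step.intros[of M N EKHole] by simp

lemma eff_steps_force_apply: "eff_step\<^sup>+\<^sup>+ (EApp (EForce (EThunk (ELam M))) V) (eff_inst M V)"
proof -
  have "eff_step (EApp (EForce (EThunk (ELam M))) V) (EApp (ELam M) V)"
    using eff_step.intros[OF eff_beta.intros(3), of "EKFrame EKHole (EFApp V)" "ELam M"] by simp
  moreover have "eff_step (EApp (ELam M) V) (eff_inst M V)"
    by (intro eff_step_beta eff_beta.intros)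
  ultimately show ?thesis
    by (meson tranclp.intros)
qed

lemma eff_steps_tr_beta: "del_beta M N \<Longrightarrow> eff_step\<^sup>+\<^sup>+ (tr s M) (tr s N)"
proof (induction rule: del_beta.induct)
  case (9 H M N)
  let ?C = "EApp (EForce (EVar 1)) (EVar 0)"
  \<comment> \<open>The value that the source rule substitutes for \<open>k\<close>.\<close>
  let ?W = "DThunk (DLam (DReset (del_fill_hoist (del_ren_hoist Suc H) (DReturn (DVar 0)))
    (del_ren (ren_up Suc) N)))"
  have "eff_step (tr s (DReset (del_fill_hoist H (DShift0 M)) N))
      (eff_inst2 ?C (EThunk (ELam (tr s M))) (tr_val s ?W))"
    \<comment> \<open>The rule renames the clauses inside the resumption; \<open>ren_up_def\<close>
      shows that \<open>?C\<close> is unchanged, so the resumption is exactly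
      \<open>tr_val s ?W\<close>.\<close>
    using eff_step_beta[OF eff_beta.intros(9)[of "fmupd s ?C fmempty" s ?C "tr_hoist s H"
          "EThunk (ELam (tr s M))" "tr s N"]]
    by (simp add: tr_del_fill_hoist tr_hoist_del_ren_hoist tr_del_ren ren_up_def fmmap_fmupd)
  \<comment> \<open>Index 1 of \<open>?C\<close> receives the suspended body and index 0 the
    resumption, which leaves a forced thunk applied to \<open>tr_val s ?W\<close>.\<close>
  also have "eff_step\<^sup>+\<^sup>+ (eff_inst2 ?C (EThunk (ELam (tr s M))) (tr_val s ?W))
      (tr s (del_inst M ?W))"
    using eff_steps_force_apply by (simp add: eff_inst2_def tr_del_inst)
  finally show ?case .
qed (auto simp: tr_del_inst tr_del_inst2 intro!: tranclp.r_into_trancl eff_step_beta eff_beta.intros)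

theorem theorem6p6:
  fixes shift0 :: 'op and M N :: "'l del_comp"
  assumes "del_step M N"
  shows "eff_step\<^sup>+\<^sup>+ (tr shift0 M) (tr shift0 N)"
  using assms by cases (auto simp: tr_del_fill intro: eff_steps_fill eff_steps_tr_beta)

end
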